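(* Let $\mathbb F$ be a field of characteristic $\neq 2$ and let $A$ be a weak PAJ over $\mathbb F$ which is generated (as an algebra) by a homogeneous set $X$ of special axes. Let $(\cdot,\cdot)$ be the Frobenius form on $A$ satisfying $(x,y)=\varphi_x(y)$ for all $x\in\operatorname{Cl}(X)$ and $y\in A$. Then every weakly primitive axis $a\in A$ which satisfies the fusion rules and $(a,a)\neq 0$ is of Jordan type (i.e. $A_0(a)^2\subseteq A_0(a)$).
   Context: Throughout, $A$ is an algebra (not necessarily commutative or associative) over a field $\mathbb F$ of characteristic $\ne 2$. $\langle\langle Y\rangle\rangle$ denotes the subalgebra generated by $Y$. For $y\in A$: $L_y(z)=yz$, $R_y(z)=zy$; $A_{\mu,\nu}(y)=\{z\in A: yz=\mu z,\ zy=\nu z\}$ and $A_\mu(y)=A_{\mu,\mu}(y)$. An axis $a\in A$ is a (nonzero) idempotent such that $A$ is the direct sum of the eigenspaces of $L_a$, $A$ is the direct sum of the eigenspaces of $R_a$, and $L_aR_a=R_aL_a$. Let $S_L(a)$, $S_R(a)$ be the sets of eigenvalues of $L_a$, $R_a$, and $S(a)=(S_L(a)\times S_R(a))\setminus\{(0,0),(1,1)\}$ (when $a$ is understood write $S=S(a)$). Then $A=A_1(a)\oplus A_0(a)\oplus\bigoplus_{(\mu,\nu)\in S}A_{\mu,\nu}(a)$. Put $S^\circ(a)=\{(\mu,\nu)\in S(a): A_{\mu,\nu}(a)\neq 0\}$ and $\tilde S^\circ(a)=\{(\nu,\mu):(\mu,\nu)\in S^\circ(a)\}$. The axis $a$ satisfies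 the fusion rules if: (a) $A_1(a)+A_0(a)$ is a subalgebra; (b) for $(\mu,\nu)\in S$, $A_{\mu,\nu}(a)$ is closed under left and right multiplication by $A_1(a)+A_0(a)$; (c) for $(\mu,\nu),(\mu',\nu')\in S$, $A_{\mu,\nu}(a)A_{\mu',\nu'}(a)\subseteq A_1(a)+A_0(a)$ if $(\mu,\nu)=(\mu',\nu')$, and $A_{\mu,\nu}(a)A_{\mu',\nu'}(a)=0$ otherwise. An axis $a$ is of Jordan type if it satisfies the fusion rules and $A_0(a)^2\subseteq A_0(a)$. It is weakly primitive if $A_1(a)=\mathbb F a$; in this case $\varphi_a(y)\in\mathbb F$ (for $y\in A$) is defined by: $\varphi_a(y)a$ is the component of $y$ in $A_1(a)$ in the decomposition $A=A_1(a)\oplus A_0(a)\oplus\bigoplus_{(\mu,\nu)\in S(a)}A_{\mu,\nu}(a)$. It is special if it is weakly primitive, satisfies the fusion rules, and for every idempotent $b\in A$ the subalgebra $B=\langle\langle a,b\rangle\rangle$ satisfies $\dim B_0(a)\le 1$. $A$ is a weak PAJ if $A=\langle\langle Y\rangle\rangle$ for some set $Y$ of weakly primitive axes of Jordan type. A set $X$ of axes is homogeneous if for all $b,c\in X$, $S^\circ(b)=S^\circ(c)$ or $S^\circ(b)=\tilde S^\circ(c)$. For an axis $a$ and $S'\subseteq S(a)$, the Miyamoto map $\tau_{a;S'}:A\to A$ is the linear map that is $-1$ on $A_{\mu,\nu}(a)$ for $(\mu,\nu)\in S'$ and $+1$ on $A_1(a)$, $A_0(a)$ and $A_{\mu,\nu}(a)$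 for $(\mu,\nu)\in S\setminus S'$; if $a$ satisfies the fusion rules it is an algebra automorphism. For a set $X$ of axes satisfying the fusion rules, $\mathcal G(X)$ is the group of automorphisms of $A$ generated by all $\tau_{x;S'}$, $x\in X$, $S'\subseteq S(x)$, and $\operatorname{Cl}(X)=\{\tau(x):x\in X,\ \tau\in\mathcal G(X)\}$. A Frobenius form on an algebra is a symmetric bilinear form with $(xy,z)=(x,yz)$ for all $x,y,z$. (Under the stated hypotheses the paper shows that a Frobenius form with $(x,y)=\varphi_x(y)$ for $x\in \operatorname{Cl}(X)$ exists, and it is unique because $\operatorname{Cl}(X)$ spans $A$.) *)

theory Defs
  imports
    Complex_Main
    "HOL.Hull"
    "HOL-Algebra.Bij"
    "HOL-Algebra.Generated_Groups"
begin

text \<open>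
  Internal direct sums. In \<open>decomposes I V y f\<close> the function \<open>f\<close> lists the components of \<open>y\<close>
  in the family \<open>V\<close>; it is forced to vanish outside \<open>I\<close>, so that it is determined by \<open>y\<close>
  when the sum is direct. The index set \<open>I\<close> may be infinite.
\<close>

definition decomposes ::
    "'i set \<Rightarrow> ('i \<Rightarrow> 'a::ab_group_add set) \<Rightarrow> 'a \<Rightarrow> ('i \<Rightarrow> 'a) \<Rightarrow> bool" where
  "decomposes I V y f \<longleftrightarrow>
     (\<forall>i\<in>I. f i \<in> V i) \<and> (\<forall>i. i \<notin> I \<longrightarrow> f i = 0) \<and>
     finite {i. f i \<noteq> 0} \<and> y = sum f {i. f i \<noteq> 0}"

definition direct_sum :: "'i set \<Rightarrow> ('i \<Rightarrow> 'a::ab_group_add set) \<Rightarrow> bool" where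
  "direct_sum I V \<longleftrightarrow> (\<forall>y. \<exists>!f. decomposes I V y f)"

text \<open>The algebra is the whole type \<open>'a\<close>; its scalar field is \<open>'f\<close>.\<close>

locale nonassoc_algebra = vector_space scale
  for scale :: "'f::field \<Rightarrow> 'a::ab_group_add \<Rightarrow> 'a"  (infixr \<open>*s\<close> 75) +
  fixes mul :: "'a \<Rightarrow> 'a \<Rightarrow> 'a"  (infixl \<open>\<cdot>\<close> 70)
  assumes linear_mul_left: "\<And>z. Vector_Spaces.linear scale scale (\<lambda>y. y \<cdot> z)"
    and linear_mul_right: "\<And>y. Vector_Spaces.linear scale scale (\<lambda>z. y \<cdot> z)"
begin

definition subalgebra :: "'a set \<Rightarrow> bool" where
  "subalgebra B \<longleftrightarrow> subspace B \<and> (\<forall>y\<in>B. \<forall>z\<in>B. y \<cdot> z \<in> B)"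

definition generated :: "'a set \<Rightarrow> 'a set" where
  "generated Y = subalgebra hull Y"

definition set_mul :: "'a set \<Rightarrow> 'a set \<Rightarrow> 'a set" where
  "set_mul U V = {u \<cdot> v | u v. u \<in> U \<and> v \<in> V}"

definition idempotent :: "'a \<Rightarrow> bool" where
  "idempotent b \<longleftrightarrow> b \<cdot> b = b"

definition left_eigenspace :: "'a \<Rightarrow> 'f \<Rightarrow> 'a set" where
  "left_eigenspace y \<mu> = {z. y \<cdot> z = \<mu> *s z}"

definition right_eigenspace :: "'a \<Rightarrow> 'f \<Rightarrow> 'a set" where
  "right_eigenspace y \<nu> = {z. z \<cdot> y = \<nu> *s z}"

definition eigenspace :: "'a \<Rightarrow> 'f \<times> 'f \<Rightarrow> 'a set" where
  "eigenspace y = (\<lambda>(\<mu>, \<nu>). {z. y \<cdot> z = \<mu> *s z \<and> z \<cdot> y = \<nu> *s z})"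

definition left_spectrum :: "'a \<Rightarrow> 'f set" where
  "left_spectrum a = {\<mu>. \<exists>z. z \<noteq> 0 \<and> a \<cdot> z = \<mu> *s z}"

definition right_spectrum :: "'a \<Rightarrow> 'f set" where
  "right_spectrum a = {\<nu>. \<exists>z. z \<noteq> 0 \<and> z \<cdot> a = \<nu> *s z}"

definition axis :: "'a \<Rightarrow> bool" where
  "axis a \<longleftrightarrow> a \<noteq> 0 \<and> idempotent a \<and>
     direct_sum (left_spectrum a) (left_eigenspace a) \<and>
     direct_sum (right_spectrum a) (right_eigenspace a) \<and>
     (\<forall>z. a \<cdot> (z \<cdot> a) = (a \<cdot> z) \<cdot> a)"

text \<open>
  \<open>S\<close>, \<open>S_circ\<close> and \<open>S_tilde\<close> are the sets usually written $S(a)$, $S^\circ(a)$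
  and $\tilde S^\circ(a)$.
\<close>

definition S :: "'a \<Rightarrow> ('f \<times> 'f) set" where
  "S a = (left_spectrum a \<times> right_spectrum a) - {(0, 0), (1, 1)}"

definition S_circ :: "'a \<Rightarrow> ('f \<times> 'f) set" where
  "S_circ a = {p \<in> S a. eigenspace a p \<noteq> {0}}"

definition S_tilde :: "'a \<Rightarrow> ('f \<times> 'f) set" where
  "S_tilde a = {(\<nu>, \<mu>) | \<mu> \<nu>. (\<mu>, \<nu>) \<in> S_circ a}"

definition core :: "'a \<Rightarrow> 'a set" \<comment> \<open>$A_1(a) + A_0(a)$\<close> where
  "core a = {u + v | u v. u \<in> eigenspace a (1, 1) \<and> v \<in> eigenspace a (0, 0)}"

definition fusion_rules :: "'a \<Rightarrow> bool" where
  "fusion_rules a \<longleftrightarrow>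
     subalgebra (core a) \<and>
     (\<forall>p\<in>S a. set_mul (core a) (eigenspace a p) \<subseteq> eigenspace a p \<and>
              set_mul (eigenspace a p) (core a) \<subseteq> eigenspace a p) \<and>
     (\<forall>p\<in>S a. \<forall>q\<in>S a. set_mul (eigenspace a p) (eigenspace a q) \<subseteq>
                        (if p = q then core a else {0}))"

definition jordan_type :: "'a \<Rightarrow> bool" where
  "jordan_type a \<longleftrightarrow> axis a \<and> fusion_rules a \<and>
     set_mul (eigenspace a (0, 0)) (eigenspace a (0, 0)) \<subseteq> eigenspace a (0, 0)"

definition weakly_primitive :: "'a \<Rightarrow> bool" where
  "weakly_primitive a \<longleftrightarrow> axis a \<and> eigenspace a (1, 1) = span {a}"

text \<open>
  The components of \<open>y\<close> in $A = A_1(a) \oplus A_0(a) \oplus \bigoplus_{S(a)} A_{\mu,\nu}(a)$,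
  meaningful when \<open>a\<close> is an axis.
\<close>

definition component :: "'a \<Rightarrow> 'a \<Rightarrow> 'f \<times> 'f \<Rightarrow> 'a" where
  "component a y = (THE f. decomposes ({(1, 1), (0, 0)} \<union> S a) (eigenspace a) y f)"

text \<open>Meaningful when \<open>a\<close> is weakly primitive.\<close>

definition \<phi> :: "'a \<Rightarrow> 'a \<Rightarrow> 'f" where
  "\<phi> a y = (THE c. c *s a = component a y (1, 1))"

text \<open>
  Since \<open>dim\<close> is \<open>0\<close> on infinite-dimensional subspaces, finite dimensionality of $B_0(a)$
  is required separately.
\<close>

definition special :: "'a \<Rightarrow> bool" where
  "special a \<longleftrightarrow> weakly_primitive a \<and> fusion_rules a \<and>
     (\<forall>b. idempotent b \<longrightarrow>
        (let B\<^sub>0 = generated {a, b} \<inter> eigenspace a (0, 0)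
         in (\<exists>T. finite T \<and> B\<^sub>0 \<subseteq> span T) \<and> dim B\<^sub>0 \<le> 1))"

definition homogeneous :: "'a set \<Rightarrow> bool" where
  "homogeneous X \<longleftrightarrow> (\<forall>b\<in>X. axis b) \<and>
     (\<forall>b\<in>X. \<forall>c\<in>X. S_circ b = S_circ c \<or> S_circ b = S_tilde c)"

text \<open>The Miyamoto map $\tau_{a;S'}$, for an axis \<open>a\<close> and $S' \subseteq S(a)$.\<close>

definition miyamoto :: "'a \<Rightarrow> ('f \<times> 'f) set \<Rightarrow> 'a \<Rightarrow> 'a" where
  "miyamoto a S' y =
     (\<Sum>p | component a y p \<noteq> 0. if p \<in> S' then - component a y p else component a y p)"

definition miyamoto_group :: "'a set \<Rightarrow> ('a \<Rightarrow> 'a) set" where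
  "miyamoto_group X = generate (BijGroup UNIV) {miyamoto x S' | x S'. x \<in> X \<and> S' \<subseteq> S x}"

definition Cl :: "'a set \<Rightarrow> 'a set" where
  "Cl X = {\<tau> x | \<tau> x. \<tau> \<in> miyamoto_group X \<and> x \<in> X}"

definition frobenius_form :: "('a \<Rightarrow> 'a \<Rightarrow> 'f) \<Rightarrow> bool" where
  "frobenius_form F \<longleftrightarrow>
     (\<forall>z. Vector_Spaces.linear scale (*) (\<lambda>y. F y z)) \<and>
     (\<forall>y. Vector_Spaces.linear scale (*) (\<lambda>z. F y z)) \<and>
     (\<forall>y z. F y z = F z y) \<and>
     (\<forall>x y z. F (x \<cdot> y) z = F x (y \<cdot> z))"

definition weak_PAJ :: bool where
  "weak_PAJ \<longleftrightarrow> (\<exists>Y. (\<forall>y\<in>Y. weakly_primitive y \<and> jordan_type y) \<and> generated Y = UNIV)"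

end

end

theory Submission
  imports Defs
begin

context nonassoc_algebra
begin

text \<open>Idempotency supplies a second factor \<open>a\<close>, which associativity of the form
  moves onto \<open>w\<close>, where it gives \<open>w \<cdot> a = 0\<close>.\<close>

lemma frobenius_form_zero_eigenspace:
  assumes F: "frobenius_form F" and "idempotent a" and w: "w \<in> eigenspace a (0, 0)"
  shows "F w a = 0"
proof -
  interpret Fl: Vector_Spaces.linear scale "(*)" "\<lambda>y. F y a"
    using F by (simp add: frobenius_form_def)
  have "F w a = F w (a \<cdot> a)"
    using \<open>idempotent a\<close> by (simp add: idempotent_def)
  also have "\<dots> = F (w \<cdot> a) a"
    using F unfolding frobenius_form_def by metis
  also have "\<dots> = 0"
    using w Fl.zero by (simp add: eigenspace_def)
  finally show ?thesis .
qed

text \<open>Associativity moves \<open>v\<close> next to \<open>a\<close>, and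
  \<open>v \<cdot> a = 0\<close>; the left factor \<open>u\<close> may be arbitrary.\<close>

lemma frobenius_form_mul_zero_eigenspace:
  assumes F: "frobenius_form F" and v: "v \<in> eigenspace a (0, 0)"
  shows "F (u \<cdot> v) a = 0"
proof -
  interpret Fr: Vector_Spaces.linear scale "(*)" "\<lambda>y. F u y"
    using F by (simp add: frobenius_form_def)
  have "F (u \<cdot> v) a = F u (v \<cdot> a)"
    using F unfolding frobenius_form_def by blast
  also have "\<dots> = 0"
    using v Fr.zero by (simp add: eigenspace_def)
  finally show ?thesis .
qed

text \<open>Lets the fusion rule that \<open>core a\<close> is a subalgebra apply to products of
  elements of $A_0(a)$.\<close>

lemma zero_eigenspace_subset_core: "eigenspace a (0, 0) \<subseteq> core a"
proof
  interpret L: Vector_Spaces.linear scale scale "\<lambda>z. a \<cdot> z"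
    by (rule linear_mul_right)
  interpret R: Vector_Spaces.linear scale scale "\<lambda>z. z \<cdot> a"
    by (rule linear_mul_left)
  fix v
  assume "v \<in> eigenspace a (0, 0)"
  moreover have "0 \<in> eigenspace a (1, 1)"
    using L.zero R.zero by (simp add: eigenspace_def)
  ultimately show "v \<in> core a"
    unfolding core_def by (intro CollectI exI[of _ 0] exI[of _ v]) simp
qed

lemma jordan_type_if_frobenius_form_neq_0:
  assumes F: "frobenius_form F" and wp: "weakly_primitive a"
    and fus: "fusion_rules a" and aa: "F a a \<noteq> 0"
  shows "jordan_type a"
proof -
  have ax: "axis a" and A1: "eigenspace a (1, 1) = span {a}"
    using wp by (auto simp: weakly_primitive_def)
  have idem: "idempotent a"
    using ax by (simp add: axis_def)
  interpret Fl: Vector_Spaces.linear scale "(*)" "\<lambda>y. F y a"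
    using F by (simp add: frobenius_form_def)
  have "u \<cdot> v \<in> eigenspace a (0, 0)"
    if u: "u \<in> eigenspace a (0, 0)" and v: "v \<in> eigenspace a (0, 0)" for u v
  proof -
    have "u \<cdot> v \<in> core a"
      using fus subsetD[OF zero_eigenspace_subset_core u] subsetD[OF zero_eigenspace_subset_core v]
      by (simp add: fusion_rules_def subalgebra_def)
    \<comment> \<open>The $A_1(a)$-part is a multiple of \<open>a\<close> by weak
      primitivity.\<close>
    then obtain c w where uv: "u \<cdot> v = c *s a + w" and w: "w \<in> eigenspace a (0, 0)"
      by (auto simp: core_def A1 span_singleton)
    \<comment> \<open>Pairing with \<open>a\<close> kills \<open>w\<close> and isolates the
      coefficient \<open>c\<close>.\<close>
    have "c * F a a = F (u \<cdot> v) a"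
      using frobenius_form_zero_eigenspace[OF F idem w] by (simp add: uv Fl.add Fl.scale)
    also have "\<dots> = 0"
      using F v by (rule frobenius_form_mul_zero_eigenspace)
    finally show ?thesis
      using aa uv w by simp
  qed
  then show ?thesis
    using ax fus by (auto simp: jordan_type_def set_mul_def)
qed

end

theorem corollary2p7:
  fixes scale :: "'f::field \<Rightarrow> 'a::ab_group_add \<Rightarrow> 'a"
    and mul :: "'a \<Rightarrow> 'a \<Rightarrow> 'a"
    and X :: "'a set"
    and form :: "'a \<Rightarrow> 'a \<Rightarrow> 'f"
    and a :: 'a
  assumes "CHAR('f) \<noteq> 2"
    and "nonassoc_algebra scale mul"
    and "nonassoc_algebra.weak_PAJ scale mul"
    and "\<And>x. x \<in> X \<Longrightarrow> nonassoc_algebra.special scale mul x"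
    and "nonassoc_algebra.homogeneous scale mul X"
    and "nonassoc_algebra.generated scale mul X = UNIV"
    and "nonassoc_algebra.frobenius_form scale mul form"
    and "\<And>x y. x \<in> nonassoc_algebra.Cl scale mul X \<Longrightarrow>
           form x y = nonassoc_algebra.\<phi> scale mul x y"
    and "nonassoc_algebra.weakly_primitive scale mul a"
    and "nonassoc_algebra.fusion_rules scale mul a"
    and "form a a \<noteq> 0"
  shows "nonassoc_algebra.jordan_type scale mul a"
  using nonassoc_algebra.jordan_type_if_frobenius_form_neq_0 assms(2,7,9-11) by blast

end
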